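(* If $z>1$ there exists a unique linear map $\Lambda:\mathcal Z_2^{z}\to\Omega\mathcal C^{z}$ such that $N\Lambda=1_{\mathcal Z_2}$ (that is, $N\Lambda A=A$ for all $A\in\mathcal Z_2^z$) and such that for all $A\in\mathcal Z_2^z$ we have $$\|\Lambda A\|_{z}\le \frac{1}{2^z-2}\sum_{i=1}^n\|A_i\|_{\rho_i,z-\rho_i}$$ if $A=\sum_{i=1}^n A_i$ with $n\ge 1$, $0<\rho_i<z$ and $A_i\in\Omega\mathcal C_2^{\rho_i,z-\rho_i}$ for $i=1,\dots,n$.
   Context: For $n\ge1$, $\Omega\mathcal C_n$ is the space of bounded continuous functions $\mathbb R^{n+1}\to\mathbb R$ which are zero whenever all $n+1$ arguments are equal; $\Omega\mathcal C:=\Omega\mathcal C_1$. For $X\in\Omega\mathcal C$, $\|X\|_z:=\sup_{s\neq t}|X_{st}|/|t-s|^z$, and $\Omega\mathcal C^z$ is the subspace of those $X\in\Omega\mathcal C$ with $\|X\|_z<\infty$. For $X\in\Omega\mathcal C_2$, $\|X\|_{\rho,\gamma}:=\sup_{(s,u,t)\in\mathbb R^3}\frac{|X_{sut}|}{|u-s|^\rho|t-u|^\gamma}$ (supremum over $s\ne u\ne t$), and $\Omega\mathcal C_2^{\rho,\gamma}$ is the subspace of those $X\in\Omega\mathcal C_2$ with $\|X\|_{\rho,\gamma}<\infty$. $\Omega\mathcal C_2^z$ is the space of finite linear combinations of elements $A_i\in\Omega\mathcal C_2^{\rho_i,z-\rho_i}$ for some $\rho_i\in(0,z)$. The linear operator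 $N:\Omega\mathcal C\to\Omega\mathcal C_2$ is $(NR)_{sut}:=R_{st}-R_{ut}-R_{su}$. Finally $\mathcal Z_2:=N(\Omega\mathcal C)$ and $\mathcal Z_2^z:=\Omega\mathcal C_2^z\cap\mathcal Z_2$.
   Formalization: The target space ΩC^z is taken without global boundedness (continuous, zero on the diagonal, finite z-norm), since for every z>1 some A in Z_2^z, e.g. N of the truncation of t−s to [−1,1], has only an unbounded preimage of finite z-norm; uniqueness holds in this larger space. *)

theory Defs
  imports "HOL-Analysis.Analysis"
begin

definition OmegaC_cont :: "(real \<times> real \<Rightarrow> real) set" where
  "OmegaC_cont = {X. continuous_on UNIV X \<and> (\<forall>t. X (t, t) = 0)}"

definition OmegaC :: "(real \<times> real \<Rightarrow> real) set" where
  "OmegaC = {X \<in> OmegaC_cont. bounded (range X)}"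

definition OmegaC2 :: "(real \<times> real \<times> real \<Rightarrow> real) set" where
  "OmegaC2 = {A. continuous_on UNIV A \<and> bounded (range A) \<and> (\<forall>t. A (t, t, t) = 0)}"

text \<open>The norms are suprema that may be infinite, hence they take values in the extended
  non-negative reals.\<close>

definition norm1 :: "real \<Rightarrow> (real \<times> real \<Rightarrow> real) \<Rightarrow> ennreal" where
  "norm1 z X = (SUP (s, t) \<in> {(s, t). s \<noteq> t}. ennreal (\<bar>X (s, t)\<bar> / \<bar>t - s\<bar> powr z))"

definition norm2 :: "real \<Rightarrow> real \<Rightarrow> (real \<times> real \<times> real \<Rightarrow> real) \<Rightarrow> ennreal" where
  "norm2 \<rho> \<gamma> A = (SUP (s, u, t) \<in> {(s, u, t). s \<noteq> u \<and> u \<noteq> t}.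
     ennreal (\<bar>A (s, u, t)\<bar> / (\<bar>u - s\<bar> powr \<rho> * \<bar>t - u\<bar> powr \<gamma>)))"

text \<open>This space is used only for the values of \<open>\<Lambda>\<close>, and its elements are continuous with finite
  \<open>z\<close>-norm but need not be globally bounded. The finite norm still bounds them on every strip
  \<open>\<bar>t - s\<bar> \<le> K\<close>. Global boundedness would make the existence of \<open>\<Lambda>\<close> false for every \<open>z > 1\<close>, although
  the members of the domain of \<open>\<Lambda>\<close> are globally bounded: see lemma \<open>no_bounded_preimage\<close> below.\<close>

definition OmegaC_pow :: "real \<Rightarrow> (real \<times> real \<Rightarrow> real) set" where
  "OmegaC_pow z = {X \<in> OmegaC_cont. norm1 z X < \<infinity>}"

definition OmegaC2_pow2 :: "real \<Rightarrow> real \<Rightarrow> (real \<times> real \<times> real \<Rightarrow> real) set" where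
  "OmegaC2_pow2 \<rho> \<gamma> = {A \<in> OmegaC2. norm2 \<rho> \<gamma> A < \<infinity>}"

definition OmegaC2_pow :: "real \<Rightarrow> (real \<times> real \<times> real \<Rightarrow> real) set" where
  "OmegaC2_pow z = {A. \<exists>(n::nat) c \<rho> B.
     (\<forall>i<n. 0 < \<rho> i \<and> \<rho> i < z \<and> B i \<in> OmegaC2_pow2 (\<rho> i) (z - \<rho> i)) \<and>
     A = (\<lambda>p. \<Sum>i<n. c i * B i p)}"

definition NN :: "(real \<times> real \<Rightarrow> real) \<Rightarrow> real \<times> real \<times> real \<Rightarrow> real" where
  "NN R = (\<lambda>(s, u, t). R (s, t) - R (u, t) - R (s, u))"

definition Z2 :: "(real \<times> real \<times> real \<Rightarrow> real) set" where
  "Z2 = NN ` OmegaC"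

definition Z2_pow :: "real \<Rightarrow> (real \<times> real \<times> real \<Rightarrow> real) set" where
  "Z2_pow z = OmegaC2_pow z \<inter> Z2"

text \<open>The counterexample is \<open>A = N R\<close> with \<open>R\<^sub>s\<^sub>t = clamp (t - s)\<close>, where \<open>clamp\<close> truncates to
  \<open>[-1, 1]\<close>: the only \<open>L\<close> with \<open>N L = A\<close> and finite \<open>z\<close>-norm is \<open>clamp (t - s) - (t - s)\<close>.\<close>

lemma no_bounded_preimage:
  fixes z :: real
  assumes z: "z > 1"
  shows "\<exists>A \<in> Z2_pow z. \<forall>L \<in> OmegaC_pow z. NN L = A \<longrightarrow> L \<notin> OmegaC"
proof -
  define f :: "real \<Rightarrow> real" where "f x = max (-1) (min 1 x)" for x
  define R :: "real \<times> real \<Rightarrow> real" where "R = (\<lambda>p. f (snd p - fst p))"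
  define A where "A = NN R"
  have f_cont [continuous_intros]: "continuous_on S (\<lambda>x. f (g x))" if "continuous_on S g"
    for S and g :: "'b::topological_space \<Rightarrow> real"
    unfolding f_def by (intro continuous_intros that)
  have R_cont: "continuous_on UNIV R"
    unfolding R_def by (intro continuous_intros)
  have R_bd: "\<bar>R p\<bar> \<le> 1" for p
    unfolding R_def f_def by auto
  have R_in: "R \<in> OmegaC"
    unfolding OmegaC_def OmegaC_cont_def using R_cont R_bd
    by (auto intro!: boundedI[of _ 1] simp: R_def f_def)
  have A_eq: "A = (\<lambda>(s, u, t). f (t - s) - f (t - u) - f (u - s))"
    unfolding A_def NN_def R_def by auto

  \<comment> \<open>A cutoff splits \<open>A\<close> according to which of the two increments is the larger one.\<close>
  define w :: "real \<Rightarrow> real" where "w x = max 0 (min 1 (1/2 + 2 * x))" for x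
  define B :: "nat \<Rightarrow> real \<times> real \<times> real \<Rightarrow> real" where
    "B i = (\<lambda>(s, u, t). (if i = 0 then w (\<bar>u - s\<bar> - \<bar>t - u\<bar>) else 1 - w (\<bar>u - s\<bar> - \<bar>t - u\<bar>)) * A (s, u, t))"
    for i
  have w01: "0 \<le> w x" "w x \<le> 1" for x unfolding w_def by auto
  have w0: "w x \<noteq> 0 \<longrightarrow> x > -1/4" and w1: "1 - w x \<noteq> 0 \<longrightarrow> x < 1/4" for x
    unfolding w_def by (auto simp: max_def min_def)
  have A_bd: "\<bar>A p\<bar> \<le> 3" for p
  proof -
    have f1: "-1 \<le> f x \<and> f x \<le> 1" for x unfolding f_def by auto
    obtain s u t where p: "p = (s, u, t)" by (cases p)
    show ?thesis using f1[of "t - s"] f1[of "t - u"] f1[of "u - s"] unfolding p A_eq by (simp add: abs_le_iff)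
  qed
  have A_cont: "continuous_on UNIV A"
    unfolding A_eq case_prod_unfold by (intro continuous_intros)
  have B_in: "B i \<in> OmegaC2" for i
  proof -
    have "continuous_on UNIV (\<lambda>p :: real \<times> real \<times> real. w (\<bar>fst (snd p) - fst p\<bar> - \<bar>snd (snd p) - fst (snd p)\<bar>))"
      unfolding w_def by (intro continuous_intros)
    hence "continuous_on UNIV (B i)"
      using A_cont unfolding B_def case_prod_unfold by (cases "i = 0") (auto intro!: continuous_intros)
    moreover have "\<bar>B i p\<bar> \<le> 1 * 3" for p
      unfolding B_def case_prod_unfold abs_mult
      by (intro mult_mono) (use w01 A_bd in auto)
    ultimately show ?thesis
      unfolding OmegaC2_def by (auto intro!: boundedI[of _ 3] simp: B_def A_eq f_def)
  qed
  have key: "\<bar>q * A (s, u, t)\<bar> / (a powr (z - 1/2) * b powr (1/2)) \<le> 6 * 4 powr (z - 1/2)"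
    if q: "0 \<le> q" "q \<le> 1" "q \<noteq> 0 \<longrightarrow> a > b - 1/4"
      and ab: "a > 0" "b > 0" "a = \<bar>u - s\<bar> \<and> b = \<bar>t - u\<bar> \<or> a = \<bar>t - u\<bar> \<and> b = \<bar>u - s\<bar>"
    for q s u t a b :: real
  proof (cases "q * A (s, u, t) = 0")
    case True
    show ?thesis unfolding True by simp
  next
    case False
    have "\<not> (\<bar>u - s\<bar> \<le> 1/2 \<and> \<bar>t - u\<bar> \<le> 1/2)"
    proof
      assume small: "\<bar>u - s\<bar> \<le> 1/2 \<and> \<bar>t - u\<bar> \<le> 1/2"
      have "f x = x" if "\<bar>x\<bar> \<le> 1" for x using that unfolding f_def by auto
      moreover have "\<bar>u - s\<bar> \<le> 1" "\<bar>t - u\<bar> \<le> 1" "\<bar>t - s\<bar> \<le> 1" using small by linarith+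
      ultimately have "f (u - s) = u - s" "f (t - u) = t - u" "f (t - s) = t - s" by blast+
      thus False using False unfolding A_eq by auto
    qed
    hence a4: "a > 1/4" using False q ab by auto
    have "\<bar>q * A (s, u, t)\<bar> \<le> 1 * \<bar>A (s, u, t)\<bar>"
      unfolding abs_mult by (intro mult_right_mono) (use q in auto)
    also have "\<bar>A (s, u, t)\<bar> \<le> 3 * min 1 b"
    proof -
      have lip: "\<bar>f (x + y) - f x - f y\<bar> \<le> 2 * \<bar>y\<bar>" for x y
        unfolding f_def by (simp add: max_def min_def abs_if)
      have "\<bar>A (s, u, t)\<bar> \<le> 2 * b"
        using ab lip[of "t - u" "u - s"] lip[of "u - s" "t - u"]
        unfolding A_eq by (auto simp: algebra_simps)
      thus ?thesis using A_bd[of "(s, u, t)"] ab by (auto simp: min_def)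
    qed
    also have "min 1 b \<le> b powr (1/2)"
    proof (cases "b \<le> 1")
      case True
      have "b powr 1 \<le> b powr (1/2)" by (rule powr_mono') (use True ab in auto)
      thus ?thesis using ab by auto
    next
      case False
      thus ?thesis using ge_one_powr_ge_zero[of b "1/2"] by auto
    qed
    finally have 1: "\<bar>q * A (s, u, t)\<bar> \<le> 3 * b powr (1/2)" by simp
    have "1 \<le> (4 * a) powr (z - 1/2)"
      using a4 z by (intro ge_one_powr_ge_zero) auto
    hence 2: "1 \<le> 4 powr (z - 1/2) * a powr (z - 1/2)"
      using ab by (simp add: powr_mult)
    have "\<bar>q * A (s, u, t)\<bar> \<le> 3 * b powr (1/2) * (4 powr (z - 1/2) * a powr (z - 1/2))"
      using 1 mult_left_mono[OF 2, of "3 * b powr (1/2)"] by simp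
    also have "\<dots> \<le> 6 * 4 powr (z - 1/2) * (a powr (z - 1/2) * b powr (1/2))"
      by (simp add: mult_ac)
    finally show ?thesis using ab by (simp add: divide_le_eq)
  qed
  have B0: "norm2 (z - 1/2) (1/2) (B 0) < \<infinity>"
  proof -
    have "norm2 (z - 1/2) (1/2) (B 0) \<le> ennreal (6 * 4 powr (z - 1/2))"
      unfolding norm2_def
    proof (rule SUP_least, clarsimp intro!: ennreal_leI)
      fix s u t :: real assume "s \<noteq> u" "u \<noteq> t"
      thus "\<bar>B 0 (s, u, t)\<bar> / (\<bar>u - s\<bar> powr (z - 1/2) * \<bar>t - u\<bar> powr (1/2)) \<le> 6 * 4 powr (z - 1/2)"
        using key[of "w (\<bar>u - s\<bar> - \<bar>t - u\<bar>)" "\<bar>t - u\<bar>" "\<bar>u - s\<bar>" u s t]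
          w01[of "\<bar>u - s\<bar> - \<bar>t - u\<bar>"] w0[of "\<bar>u - s\<bar> - \<bar>t - u\<bar>"]
        unfolding B_def by auto
    qed
    thus ?thesis by (rule le_less_trans) simp
  qed
  have B1: "norm2 (1/2) (z - 1/2) (B 1) < \<infinity>"
  proof -
    have "norm2 (1/2) (z - 1/2) (B 1) \<le> ennreal (6 * 4 powr (z - 1/2))"
      unfolding norm2_def
    proof (rule SUP_least, clarsimp intro!: ennreal_leI)
      fix s u t :: real assume "s \<noteq> u" "u \<noteq> t"
      hence "\<bar>B 1 (s, u, t)\<bar> / (\<bar>t - u\<bar> powr (z - 1/2) * \<bar>u - s\<bar> powr (1/2)) \<le> 6 * 4 powr (z - 1/2)"
        using key[of "1 - w (\<bar>u - s\<bar> - \<bar>t - u\<bar>)" "\<bar>u - s\<bar>" "\<bar>t - u\<bar>" u s t]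
          w01[of "\<bar>u - s\<bar> - \<bar>t - u\<bar>"] w1[of "\<bar>u - s\<bar> - \<bar>t - u\<bar>"]
        unfolding B_def by auto
      thus "\<bar>B (Suc 0) (s, u, t)\<bar> / (\<bar>u - s\<bar> powr (1/2) * \<bar>t - u\<bar> powr (z - 1/2)) \<le> 6 * 4 powr (z - 1/2)"
        by (simp add: mult.commute)
    qed
    thus ?thesis by (rule le_less_trans) simp
  qed
  have "A \<in> OmegaC2_pow z"
    unfolding OmegaC2_pow_def
  proof (intro CollectI exI conjI)
    show "\<forall>i<2. 0 < (if i = 0 then z - 1/2 else 1/2) \<and> (if i = 0 then z - 1/2 else 1/2) < z \<and>
        B i \<in> OmegaC2_pow2 (if i = 0 then z - 1/2 else 1/2) (z - (if i = 0 then z - 1/2 else 1/2))"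
      using z B0 B1 B_in unfolding OmegaC2_pow2_def by (auto simp: less_2_cases_iff)
    show "A = (\<lambda>p. \<Sum>i<2. (\<lambda>_. 1) i * B i p)"
      unfolding B_def by (auto simp: numeral_2_eq_2 algebra_simps)
  qed
  hence A_in: "A \<in> Z2_pow z"
    unfolding Z2_pow_def Z2_def A_def using R_in by auto
  moreover have "L \<notin> OmegaC" if L: "L \<in> OmegaC_pow z" "NN L = A" for L
  proof
    assume "L \<in> OmegaC"
    then obtain K where K: "\<And>p. \<bar>L p\<bar> \<le> K"
      unfolding OmegaC_def bounded_iff by auto
    have fin: "norm1 z L < \<infinity>" using L unfolding OmegaC_pow_def by auto
    define C where "C = enn2real (norm1 z L)"
    have C: "\<bar>L (s, t)\<bar> \<le> C * \<bar>t - s\<bar> powr z" if "s \<noteq> t" for s t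
    proof -
      have "ennreal (\<bar>L (s, t)\<bar> / \<bar>t - s\<bar> powr z) \<le> norm1 z L"
        unfolding norm1_def by (rule SUP_upper2[of "(s, t)"]) (use that in auto)
      also have "\<dots> = ennreal C" using fin unfolding C_def by simp
      finally have "\<bar>L (s, t)\<bar> / \<bar>t - s\<bar> powr z \<le> C"
        unfolding C_def by (simp add: ennreal_le_iff)
      thus ?thesis using that by (simp add: divide_le_eq)
    qed
    have add: "R (s, t) - L (s, t) = (R (s, u) - L (s, u)) + (R (u, t) - L (u, t))" for s u t
      using fun_cong[OF L(2), of "(s, u, t)"] unfolding A_def NN_def by simp
    define h where "h t = R (0, t) - L (0, t) - t" for t
    have h: "\<bar>h (s + k) - h s\<bar> \<le> C * \<bar>k\<bar> powr z" if "k \<noteq> 0" "\<bar>k\<bar> \<le> 1" for s k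
    proof -
      have "h (s + k) - h s = - L (s, s + k)"
        using add[of 0 "s + k" s] that unfolding h_def R_def f_def by auto
      thus ?thesis using C[of s "s + k"] that by auto
    qed
    have "(h has_real_derivative 0) (at s)" for s
      unfolding DERIV_def
    proof (rule Lim_null_comparison)
      show "eventually (\<lambda>k. norm ((h (s + k) - h s) / k) \<le> C * \<bar>k\<bar> powr (z - 1)) (at 0)"
        unfolding eventually_at
      proof (intro exI[of _ 1] conjI ballI impI)
        fix k :: real assume k: "k \<noteq> 0 \<and> dist k 0 < 1"
        have "\<bar>h (s + k) - h s\<bar> \<le> C * \<bar>k\<bar> powr (z - 1) * \<bar>k\<bar>"
          using h[of k s] k by (simp add: powr_diff)
        thus "norm ((h (s + k) - h s) / k) \<le> C * \<bar>k\<bar> powr (z - 1)"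
          using k by (simp add: divide_le_eq)
      qed simp
      have "((\<lambda>k::real. C * \<bar>k\<bar> powr (z - 1)) \<longlongrightarrow> C * \<bar>0\<bar> powr (z - 1)) (at 0)"
        by (intro tendsto_intros tendsto_powr2) (use z in auto)
      thus "((\<lambda>k::real. C * \<bar>k\<bar> powr (z - 1)) \<longlongrightarrow> 0) (at 0)" by simp
    qed
    hence "h t = h 0" for t by (intro DERIV_isconst_all allI)
    moreover have "h 0 = 0" 
      using L unfolding h_def R_def f_def OmegaC_pow_def OmegaC_cont_def by auto
    ultimately have h_zero: "h t = 0" for t by metis
    have "L (0, t) = R (0, t) - t" for t using h_zero[of t] unfolding h_def by simp
    from this[of "\<bar>K\<bar> + 2"] K[of "(0, \<bar>K\<bar> + 2)"] R_bd[of "(0, \<bar>K\<bar> + 2)"] show False by linarith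
  qed
  ultimately show ?thesis by blast
qed

end

theory Submission
  imports Defs
begin

text \<open>
  Write \<open>A = N R\<close> and let \<open>R\<^sub>n (s, t)\<close> be the sum of \<open>R\<close> over the \<open>2\<^sup>n\<close> equal pieces of the interval
  from \<open>s\<close> to \<open>t\<close>. Halving the pieces lowers this sum by the values of \<open>A\<close> at the \<open>2\<^sup>n\<close> pieces, each
  split at its midpoint; call the total decrease \<open>dyadic_sum A n s t\<close>. The image \<open>\<Lambda> A\<close>
  is the series of these decreases (\<open>sewing\<close>), so that \<open>I = R - \<Lambda> A\<close> is the limit of the \<open>R\<^sub>n\<close>, the
  additive part of \<open>R\<close>. The formula is linear in \<open>A\<close> and does not mention \<open>R\<close>.

  A decomposition of \<open>A\<close> with norms \<open>K\<^sub>i\<close> gives, at a midpoint, \<open>\<bar>A\<bar> \<le> K (\<bar>t - s\<bar> / 2)\<^sup>z\<close> with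
  \<open>K = \<Sum> K\<^sub>i\<close>: both increments are equal there, so that only the sum \<open>z\<close> of the two exponents
  \<open>\<rho>\<^sub>i\<close> and \<open>z - \<rho>\<^sub>i\<close> matters.
  The sum at level \<open>n\<close> is then at most \<open>K (\<bar>t - s\<bar> / 2)\<^sup>z\<close> times \<open>2\<^sup>n\<close> over \<open>2\<close> to the power \<open>n z\<close>, and
  for \<open>z > 1\<close> the geometric series sums to \<open>K \<bar>t - s\<bar>\<^sup>z / (2\<^sup>z - 2)\<close>, which is the claimed bound
  (\<open>sewing_le\<close>). Convergence is uniform on strips of bounded \<open>\<bar>t - s\<bar>\<close>, whence continuity.

  By construction \<open>I\<close> is additive at midpoints; the point of \<open>N \<Lambda> A = A\<close> is that it is additive at all
  points. Since \<open>N I = A - N (\<Lambda> A)\<close>, the function \<open>N I\<close> is bounded by a multiple of \<open>d\<^sup>z\<close> on triples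
  whose steps are at most \<open>d\<close>. A quantity bounded in this way whose value at scale \<open>2 h\<close> is the sum of two values at
  scale \<open>h\<close> must vanish, because \<open>n\<close> halvings produce \<open>2\<^sup>n\<close> terms that shrink faster than \<open>2\<^sup>n\<close> grows
  (\<open>halving_scale_eq_0\<close>). This shows in turn that \<open>I\<close> is antisymmetric and that it is additive over
  any number of equal pieces, hence on every arithmetic progression, hence everywhere by continuity
  (\<open>midpoint_additive.additive\<close>). The same lemma, applied to the difference of two candidates for
  \<open>\<Lambda> A\<close>, gives uniqueness.
\<close>

section \<open>Rigidity of functions that add up over midpoints\<close>

text \<open>After \<open>n\<close> halvings \<open>F s h\<close> is a sum of \<open>2\<^sup>n\<close> values at scale \<open>h / 2\<^sup>n\<close>, so it is of order
  \<open>2\<^sup>n\<close> over \<open>2\<close> to the power \<open>n z\<close>, which tends to \<open>0\<close>. The factor \<open>k\<close> allows \<open>F s h\<close> to describe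
  an interval that consists of \<open>k\<close> pieces of length \<open>h\<close>.\<close>

lemma halving_scale_eq_0:
  fixes F :: "real \<Rightarrow> real \<Rightarrow> real"
  assumes "z > 1"
    and double: "\<And>s h. F s (2 * h) = F s h + F (s + k * h) h"
    and bound: "\<And>s h. \<bar>F s h\<bar> \<le> C * \<bar>h\<bar> powr z"
  shows "F s h = 0"
proof -
  define r where "r = 2 powr (1 - z)"
  have r: "0 < r" "r < 1" using assms(1) unfolding r_def by (auto simp: powr_less_one)
  have "\<bar>F s h\<bar> \<le> C * \<bar>h\<bar> powr z * r ^ n" for s h n
  proof (induction n arbitrary: s h)
    case 0
    show ?case using bound by simp
  next
    case (Suc n)
    have "\<bar>F s h\<bar> \<le> \<bar>F s (h / 2)\<bar> + \<bar>F (s + k * (h / 2)) (h / 2)\<bar>"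
      using double[of s "h / 2"] by simp
    also have "\<dots> \<le> 2 * (C * \<bar>h / 2\<bar> powr z * r ^ n)"
      using Suc[of s "h / 2"] Suc[of "s + k * (h / 2)" "h / 2"] by linarith
    also have "\<dots> = C * \<bar>h\<bar> powr z * r ^ Suc n"
      by (simp add: r_def powr_divide powr_diff)
    finally show ?case .
  qed
  moreover have "(\<lambda>n. C * \<bar>h\<bar> powr z * r ^ n) \<longlonglongrightarrow> C * \<bar>h\<bar> powr z * 0"
    using r by (intro tendsto_intros LIMSEQ_realpow_zero) auto
  ultimately have "\<bar>F s h\<bar> \<le> 0"
    by (intro LIMSEQ_le_const[of _ _ "\<bar>F s h\<bar>"]) auto
  thus ?thesis by simp
qed

lemma sum_lessThan_add_split:
  "(\<Sum>i<n + m. g i) = (\<Sum>i<n. g i) + (\<Sum>i<m. g (n + i))" for g :: "nat \<Rightarrow> 'a::comm_monoid_add"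
  by (induction m) (simp_all add: add.assoc)

lemma sum_consecutive_pairs:
  "(\<Sum>i<k. g (2 * i) + g (Suc (2 * i))) = (\<Sum>j<k + k. g j)" for g :: "nat \<Rightarrow> 'a::comm_monoid_add"
  by (induction k) (simp_all add: add.assoc mult_2)

lemma continuous_on_NN:
  assumes "continuous_on UNIV R"
  shows "continuous_on UNIV (NN R)"
proof -
  have *: "continuous_on UNIV (\<lambda>p :: real \<times> real \<times> real. R (f p, g p))"
    if "continuous_on UNIV f" "continuous_on UNIV g" for f g
    using continuous_on_compose2[OF assms continuous_on_Pair[OF that]] by simp
  show ?thesis
    unfolding NN_def case_prod_unfold
    by (intro continuous_on_diff * continuous_on_fst continuous_on_snd continuous_on_id)
qed

text \<open>The bound on \<open>N I\<close> cannot be dropped: \<open>\<bar>t - s\<bar>\<close> is additive at midpoints, and so is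
  \<open>\<bar>t - s\<bar> g (log\<^sub>2 \<bar>t - s\<bar>)\<close> for each \<open>1\<close>-periodic \<open>g\<close>.\<close>

locale midpoint_additive =
  fixes I :: "real \<times> real \<Rightarrow> real" and C z :: real
  assumes z: "z > 1"
    and mid: "\<And>s t. I (s, t) = I (s, (s + t) / 2) + I ((s + t) / 2, t)"
    and bound: "\<And>s u t d. \<bar>u - s\<bar> \<le> d \<Longrightarrow> \<bar>t - u\<bar> \<le> d \<Longrightarrow> \<bar>NN I (s, u, t)\<bar> \<le> C * d powr z"
begin

text \<open>The sum \<open>I (s, t) + I (t, s)\<close> is itself additive at midpoints, and it equals \<open>- N I (s, t, s)\<close>.\<close>

lemma antisymmetric:
  shows "I (t, s) = - I (s, t)"
proof -
  have I0: "I (s, s) = 0" for s using mid[of s s] by simp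
  have "I (s, s + h) + I (s + h, s) = 0" for s h
  proof (rule halving_scale_eq_0[OF z, of "\<lambda>s h. I (s, s + h) + I (s + h, s)" 1])
    show "I (s, s + 2 * h) + I (s + 2 * h, s) =
        I (s, s + h) + I (s + h, s) + (I (s + 1 * h, s + 1 * h + h) + I (s + 1 * h + h, s + 1 * h))" for s h
    proof -
      have "(s + (s + 2 * h)) / 2 = s + h" "(s + 2 * h + s) / 2 = s + h" by simp_all
      moreover have "s + h + h = s + 2 * h" by simp
      ultimately show ?thesis
        using mid[of s "s + 2 * h"] mid[of "s + 2 * h" s] by (simp only: mult_1)
    qed
    show "\<bar>I (s, s + h) + I (s + h, s)\<bar> \<le> C * \<bar>h\<bar> powr z" for s h
      using bound[of "s + h" s "\<bar>h\<bar>" s] by (simp add: NN_def I0)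
  qed
  from this[of s "t - s"] show ?thesis by simp
qed

text \<open>The defect \<open>E\<close> of this identity satisfies the hypotheses of \<open>halving_scale_eq_0\<close>. It is of order \<open>\<bar>h\<bar>\<^sup>z\<close>
  because it is a telescoping sum of \<open>k\<close> values of \<open>N I\<close>. It doubles because cutting each of \<open>k\<close>
  pieces of length \<open>2 h\<close> at its midpoint gives the pieces of two adjacent intervals of length \<open>k h\<close>.\<close>

lemma equal_parts:
  shows "I (s, s + real k * h) = (\<Sum>i<k. I (s + real i * h, s + real (Suc i) * h))"
proof -
  define E where
    "E k s h = I (s, s + real k * h) - (\<Sum>i<k. I (s + real i * h, s + real (Suc i) * h))" for k s h
  have I0: "I (s, s) = 0" for s using mid[of s s] by simp
  have "\<exists>D. \<forall>s h. \<bar>E k s h\<bar> \<le> D * \<bar>h\<bar> powr z"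
  proof (induction k)
    case 0
    show ?case by (auto simp: E_def I0 intro!: exI[of _ 0])
  next
    case (Suc k)
    then obtain D where D: "\<And>s h. \<bar>E k s h\<bar> \<le> D * \<bar>h\<bar> powr z" by blast
    have "\<bar>E (Suc k) s h\<bar> \<le> (D + C * real (Suc k) powr z) * \<bar>h\<bar> powr z" for s h
    proof -
      have "E (Suc k) s h = E k s h + NN I (s, s + real k * h, s + real (Suc k) * h)"
        by (simp add: E_def NN_def)
      moreover have "\<bar>NN I (s, s + real k * h, s + real (Suc k) * h)\<bar> \<le> C * (real (Suc k) * \<bar>h\<bar>) powr z"
        by (rule bound) (auto simp: abs_mult algebra_simps)
      ultimately show ?thesis
        using D[of s h] by (simp add: powr_mult distrib_right mult.assoc del: of_nat_Suc)
    qed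
    thus ?case by blast
  qed
  then obtain D where D: "\<And>s h. \<bar>E k s h\<bar> \<le> D * \<bar>h\<bar> powr z" by blast
  have "E k s (2 * h) = E k s h + E k (s + real k * h) h" for s h
  proof -
    define g where "g j = I (s + real j * h, s + real (Suc j) * h)" for j
    have "(\<Sum>i<k. I (s + real i * (2 * h), s + real (Suc i) * (2 * h))) =
        (\<Sum>i<k. g (2 * i) + g (Suc (2 * i)))"
    proof (rule sum.cong[OF refl])
      fix i
      have "(s + real i * (2 * h) + (s + real (Suc i) * (2 * h))) / 2 = s + real (Suc (2 * i)) * h"
        "s + real i * (2 * h) = s + real (2 * i) * h"
        "s + real (Suc i) * (2 * h) = s + real (Suc (Suc (2 * i))) * h"
        by (simp_all add: field_simps)
      thus "I (s + real i * (2 * h), s + real (Suc i) * (2 * h)) = g (2 * i) + g (Suc (2 * i))"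
        using mid[of "s + real i * (2 * h)" "s + real (Suc i) * (2 * h)"]
        by (simp only: g_def)
    qed
    also have "\<dots> = (\<Sum>j<k. g j) + (\<Sum>j<k. g (k + j))"
      by (simp only: sum_consecutive_pairs sum_lessThan_add_split)
    also have "(\<Sum>j<k. g (k + j)) =
        (\<Sum>j<k. I (s + real k * h + real j * h, s + real k * h + real (Suc j) * h))"
      by (simp add: g_def algebra_simps)
    finally have "(\<Sum>i<k. I (s + real i * (2 * h), s + real (Suc i) * (2 * h))) =
        (\<Sum>j<k. I (s + real j * h, s + real (Suc j) * h)) +
        (\<Sum>j<k. I (s + real k * h + real j * h, s + real k * h + real (Suc j) * h))"
      by (simp only: g_def)
    moreover have "I (s, s + real k * (2 * h)) =
        I (s, s + real k * h) + I (s + real k * h, s + real k * h + real k * h)"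
    proof -
      have "(s + (s + real k * h + real k * h)) / 2 = s + real k * h"
        "s + real k * (2 * h) = s + real k * h + real k * h" by (simp_all add: field_simps)
      thus ?thesis using mid[of s "s + real k * h + real k * h"] by (simp only:)
    qed
    ultimately show ?thesis unfolding E_def by simp
  qed
  from halving_scale_eq_0[OF z this D] have "E k s h = 0" .
  thus ?thesis by (simp add: E_def)
qed

text \<open>On a progression \<open>b + j h\<close> all values of \<open>I\<close> are differences of the partial sums
  \<open>I (b, b + j h)\<close>, so \<open>N I\<close> vanishes there. The three given points are limits of points of the
  progressions with step \<open>1 / n\<close> that start at the smallest of them.\<close>

lemma additive:
  assumes cont: "continuous_on UNIV I"
  shows "NN I (s, u, t) = 0"
proof -
  have le: "I (b + real p * h, b + real q * h) = I (b, b + real q * h) - I (b, b + real p * h)"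
    if pq: "p \<le> q" for b h p q
  proof -
    obtain m where q: "q = p + m" using le_Suc_ex[OF pq] by blast
    define g where "g j = I (b + real j * h, b + real (Suc j) * h)" for j
    \<comment> \<open>The pieces between \<open>b + p h\<close> and \<open>b + q h\<close> are pieces number \<open>p, \<dots>, q - 1\<close> counted from \<open>b\<close>.\<close>
    have shift: "b + real p * h + real j * h = b + real (p + j) * h" for j
      by (simp add: distrib_right)
    have "I (b + real p * h, b + real q * h) = (\<Sum>j<m. g (p + j))"
      using equal_parts[of "b + real p * h" m h] unfolding shift by (simp add: g_def q)
    moreover have "I (b, b + real k * h) = (\<Sum>j<k. g j)" for k
      using equal_parts[of b k h] by (simp only: g_def)
    ultimately show ?thesis
      by (simp only: q sum_lessThan_add_split add_diff_cancel_left')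
  qed
  have grid: "NN I (b + real p * h, b + real q * h, b + real r * h) = 0" for b h p q r
  proof -
    have "I (b + real p * h, b + real q * h) = I (b, b + real q * h) - I (b, b + real p * h)" for p q
    proof (cases "p \<le> q")
      case False
      hence "I (b + real q * h, b + real p * h) = I (b, b + real p * h) - I (b, b + real q * h)"
        by (intro le) simp
      thus ?thesis using antisymmetric[of "b + real p * h" "b + real q * h"] by linarith
    qed (rule le)
    thus ?thesis by (simp add: NN_def)
  qed
  define b where "b = min s (min u t)"
  define x where "x v n = b + real (nat \<lfloor>real n * (v - b)\<rfloor>) * (1 / real n)" for v n
  have x: "x v \<longlonglongrightarrow> v" if "b \<le> v" for v
  proof -
    have "eventually (\<lambda>n. norm (x v n - v) \<le> inverse (real n)) sequentially"
      using eventually_gt_at_top[of 0]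
    proof eventually_elim
      case (elim n)
      define y where "y = real n * (v - b)"
      have "y \<ge> 0" using that by (simp add: y_def)
      hence "x v n - v = (of_int \<lfloor>y\<rfloor> - y) / real n"
        using elim by (simp add: x_def y_def[symmetric]) (simp add: y_def field_simps)
      moreover have "\<bar>of_int \<lfloor>y\<rfloor> - y\<bar> \<le> 1" by linarith
      ultimately show ?case using elim by (simp add: inverse_eq_divide divide_right_mono)
    qed
    hence "(\<lambda>n. x v n - v) \<longlonglongrightarrow> 0"
      by (rule Lim_null_comparison[OF _ lim_inverse_n])
    thus ?thesis by (simp add: LIM_zero_iff)
  qed
  have lim: "(\<lambda>n. (x s n, x u n, x t n)) \<longlonglongrightarrow> (s, u, t)"
    by (intro tendsto_Pair x) (auto simp: b_def)
  have "(\<lambda>n. NN I (x s n, x u n, x t n)) \<longlonglongrightarrow> NN I (s, u, t)"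
    by (rule continuous_on_tendsto_compose[OF continuous_on_NN[OF cont] lim]) auto
  moreover have "(\<lambda>n. NN I (x s n, x u n, x t n)) = (\<lambda>n. 0)"
    by (simp only: x_def grid)
  ultimately have "(\<lambda>n. 0) \<longlonglongrightarrow> NN I (s, u, t)" by (simp only:)
  from LIMSEQ_unique[OF this tendsto_const] show ?thesis .
qed

end

section \<open>The dyadic series\<close>

text \<open>Level \<open>n\<close> sums \<open>A\<close> over the \<open>2\<^sup>n\<close> equal pieces of the interval from \<open>s\<close> to \<open>t\<close>, each split at
  its midpoint. The recursion halves the interval first, so that additivity of the series at
  midpoints is an index shift.\<close>

primrec dyadic_sum :: "(real \<times> real \<times> real \<Rightarrow> real) \<Rightarrow> nat \<Rightarrow> real \<Rightarrow> real \<Rightarrow> real" where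
  "dyadic_sum A 0 s t = A (s, (s + t) / 2, t)"
| "dyadic_sum A (Suc n) s t = dyadic_sum A n s ((s + t) / 2) + dyadic_sum A n ((s + t) / 2) t"

definition sewing :: "(real \<times> real \<times> real \<Rightarrow> real) \<Rightarrow> real \<times> real \<Rightarrow> real" where
  "sewing A = (\<lambda>(s, t). \<Sum>n. dyadic_sum A n s t)"

lemma dyadic_sum_lincomb:
  "dyadic_sum (\<lambda>p. a * A p + b * B p) n s t = a * dyadic_sum A n s t + b * dyadic_sum B n s t"
  by (induction n arbitrary: s t) (simp_all add: algebra_simps)

lemma dyadic_sum_diag: "(\<And>t. A (t, t, t) = 0) \<Longrightarrow> dyadic_sum A n t t = 0"
  by (induction n) simp_all

lemma continuous_on_dyadic_sum:
  assumes "continuous_on UNIV A"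
  shows "continuous_on UNIV (\<lambda>p. dyadic_sum A n (fst p) (snd p))"
proof (induction n)
  case 0
  show ?case by (simp, intro continuous_on_compose2[OF assms] continuous_intros) auto
next
  case (Suc n)
  have *: "continuous_on UNIV (\<lambda>p::real \<times> real. dyadic_sum A n (f p) (g p))"
    if "continuous_on UNIV f" "continuous_on UNIV g" for f g
    using continuous_on_compose2[OF Suc continuous_on_Pair[OF that]] by simp
  show ?case by (simp, intro continuous_on_add * continuous_intros) auto
qed

text \<open>Convergence, size and continuity of the series depend on \<open>A\<close> at midpoints only. The constant
  \<open>K\<close> is kept explicit since it carries the sharp factor \<open>1 / (2\<^sup>z - 2)\<close>.\<close>

locale midpoint_control =
  fixes A :: "real \<times> real \<times> real \<Rightarrow> real" and K z :: real
  assumes z: "z > 1"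
    and mid_le: "\<And>s t. \<bar>A (s, (s + t) / 2, t)\<bar> \<le> K * (\<bar>t - s\<bar> / 2) powr z"
begin

lemma K_nonneg: "K \<ge> 0"
  using mid_le[of 0 2] by simp

lemma ratio: "0 < 2 powr (1 - z)" "2 powr (1 - z) < 1"
  using z by (auto simp: powr_less_one)

lemma dyadic_sum_le:
  "\<bar>dyadic_sum A n s t\<bar> \<le> K * (\<bar>t - s\<bar> / 2) powr z * (2 powr (1 - z)) ^ n"
proof (induction n arbitrary: s t)
  case 0
  show ?case using mid_le by simp
next
  case (Suc n)
  let ?m = "(s + t) / 2"
  have half: "\<bar>?m - s\<bar> = \<bar>t - s\<bar> / 2" "\<bar>t - ?m\<bar> = \<bar>t - s\<bar> / 2" by (auto simp: abs_if field_simps)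
  have "\<bar>dyadic_sum A (Suc n) s t\<bar> \<le> \<bar>dyadic_sum A n s ?m\<bar> + \<bar>dyadic_sum A n ?m t\<bar>"
    by simp
  also have "\<dots> \<le> 2 * (K * (\<bar>t - s\<bar> / 2 / 2) powr z * (2 powr (1 - z)) ^ n)"
    using Suc[of s ?m] Suc[of ?m t] unfolding half by linarith
  also have "\<dots> = K * (\<bar>t - s\<bar> / 2) powr z * (2 powr (1 - z)) ^ Suc n"
  proof -
    have "(\<bar>t - s\<bar> / 2 / 2) powr z = (\<bar>t - s\<bar> / 2) powr z / 2 powr z"
      by (rule powr_divide)
    moreover have "2 powr (1 - z) = 2 / 2 powr z" by (simp add: powr_diff)
    ultimately show ?thesis by simp
  qed
  finally show ?case .
qed

lemma summable_bound: "summable (\<lambda>n. c * (2 powr (1 - z)) ^ n)"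
  using ratio by (intro summable_mult summable_geometric) auto

lemma summable_dyadic_sum: "summable (\<lambda>n. dyadic_sum A n s t)"
  by (rule summable_comparison_test[OF _ summable_bound])
     (use dyadic_sum_le in \<open>auto intro!: exI[of _ 0]\<close>)

lemma sewing_le: "\<bar>sewing A (s, t)\<bar> \<le> 1 / (2 powr z - 2) * K * \<bar>t - s\<bar> powr z"
proof -
  define c where "c = K * (\<bar>t - s\<bar> / 2) powr z"
  have le: "norm (dyadic_sum A n s t) \<le> c * (2 powr (1 - z)) ^ n" for n
    using dyadic_sum_le by (simp add: c_def)
  have "norm (sewing A (s, t)) \<le> (\<Sum>n. norm (dyadic_sum A n s t))"
    unfolding sewing_def prod.case
    by (rule summable_norm[OF summable_comparison_test'[OF summable_bound]]) (use le in simp)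
  also have "\<dots> \<le> (\<Sum>n. c * (2 powr (1 - z)) ^ n)"
    by (rule suminf_le[OF le summable_comparison_test'[OF summable_bound] summable_bound])
       (use le in simp)
  also have "\<dots> = c * (1 / (1 - 2 powr (1 - z)))"
    using ratio by (subst suminf_mult) (simp_all add: suminf_geometric summable_geometric)
  also have "\<dots> = 1 / (2 powr z - 2) * K * \<bar>t - s\<bar> powr z"
  proof -
    have "2 powr (1 - z) * 2 powr z = 2" by (simp flip: powr_add)
    moreover have "2 powr z > 2 powr 1" using z by (intro powr_less_mono) auto
    ultimately have "(1 - 2 powr (1 - z)) * 2 powr z = 2 powr z - 2" "2 powr z \<noteq> 0"
      by (simp_all add: left_diff_distrib)
    hence "1 / (2 powr z - 2) = 1 / 2 powr z * (1 / (1 - 2 powr (1 - z)))"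
      by (metis divide_divide_eq_left mult.commute times_divide_eq_right mult_1)
    thus ?thesis by (simp add: c_def powr_divide)
  qed
  finally have "norm (sewing A (s, t)) \<le> 1 / (2 powr z - 2) * K * \<bar>t - s\<bar> powr z" .
  thus ?thesis by (simp only: real_norm_def)
qed

text \<open>The majorant depends on \<open>\<bar>t - s\<bar>\<close>, so uniform convergence holds only on the strips \<open>U\<close>; these
  are open and cover the plane.\<close>

lemma continuous_on_sewing:
  assumes "continuous_on UNIV A"
  shows "continuous_on UNIV (sewing A)"
proof -
  have "isCont (sewing A) p" for p
  proof -
    define c where "c = \<bar>snd p - fst p\<bar> + 1"
    define U where "U = {q :: real \<times> real. \<bar>snd q - fst q\<bar> < c}"
    have U: "open U" unfolding U_def by (intro open_Collect_less continuous_intros)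
    have "uniform_limit U (\<lambda>n q. \<Sum>i<n. dyadic_sum A i (fst q) (snd q))
        (\<lambda>q. \<Sum>i. dyadic_sum A i (fst q) (snd q)) sequentially"
    proof (rule Weierstrass_m_test)
      show "norm (dyadic_sum A n (fst q) (snd q)) \<le> K * (c / 2) powr z * (2 powr (1 - z)) ^ n"
        if "q \<in> U" for n q
      proof -
        have "K * (\<bar>snd q - fst q\<bar> / 2) powr z \<le> K * (c / 2) powr z"
          using that K_nonneg z by (intro mult_left_mono powr_mono2) (auto simp: U_def)
        hence "K * (\<bar>snd q - fst q\<bar> / 2) powr z * (2 powr (1 - z)) ^ n
            \<le> K * (c / 2) powr z * (2 powr (1 - z)) ^ n"
          by (rule mult_right_mono) simp
        thus ?thesis using dyadic_sum_le[of n "fst q" "snd q"] by simp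
      qed
    qed (rule summable_bound)
    hence "continuous_on U (\<lambda>q. \<Sum>i. dyadic_sum A i (fst q) (snd q))"
      by (rule uniform_limit_theorem[rotated])
         (auto intro!: always_eventually continuous_on_sum
           continuous_on_subset[OF continuous_on_dyadic_sum[OF assms]])
    hence "continuous_on U (sewing A)" by (simp add: sewing_def case_prod_unfold)
    moreover have "p \<in> U" by (simp add: U_def c_def)
    ultimately show ?thesis using U continuous_on_eq_continuous_at by blast
  qed
  thus ?thesis by (auto simp: continuous_on_eq_continuous_at)
qed

text \<open>The term of index \<open>0\<close> is the right-hand side, and the remaining terms form the series on the
  two halves of the interval.\<close>

lemma NN_sewing_midpoint: "NN (sewing A) (s, (s + t) / 2, t) = A (s, (s + t) / 2, t)"
proof -
  have "sewing A (s, t) = A (s, (s + t) / 2, t) + (\<Sum>n. dyadic_sum A (Suc n) s t)"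
    using suminf_split_head[OF summable_dyadic_sum, of s t] by (simp add: sewing_def)
  also have "(\<Sum>n. dyadic_sum A (Suc n) s t) = sewing A (s, (s + t) / 2) + sewing A ((s + t) / 2, t)"
    by (simp add: sewing_def suminf_add summable_dyadic_sum)
  finally show ?thesis by (simp add: NN_def)
qed

end

text \<open>Take \<open>d = \<bar>t - s\<bar> / 2\<close> for the midpoint.\<close>

lemma midpoint_controlI:
  assumes "z > 1"
    and "\<And>s u t d. \<bar>u - s\<bar> \<le> d \<Longrightarrow> \<bar>t - u\<bar> \<le> d \<Longrightarrow> \<bar>A (s, u, t)\<bar> \<le> K * d powr z"
  shows "midpoint_control A K z"
  by unfold_locales (use assms in \<open>auto simp: abs_if field_simps\<close>)

text \<open>The midpoint identity only makes \<open>I = R - sewing A\<close> additive at midpoints. Full additivity of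
  \<open>I\<close> follows by rigidity, for which \<open>N I = A - N (sewing A)\<close> must be bounded at arbitrary triples:
  the bound on \<open>A\<close> is a hypothesis, and each of the three values of \<open>sewing A\<close> is controlled by
  \<open>sewing_le\<close>.\<close>

lemma NN_sewing:
  assumes z: "z > 1" and R: "R \<in> OmegaC" and A: "A = NN R"
    and bound: "\<And>s u t d. \<bar>u - s\<bar> \<le> d \<Longrightarrow> \<bar>t - u\<bar> \<le> d \<Longrightarrow> \<bar>A (s, u, t)\<bar> \<le> K * d powr z"
  shows "NN (sewing A) = A"
proof -
  have R_cont: "continuous_on UNIV R" using R by (auto simp: OmegaC_def OmegaC_cont_def)
  have A_cont: "continuous_on UNIV A"
    unfolding A by (rule continuous_on_NN[OF R_cont])
  interpret midpoint_control A K z by (rule midpoint_controlI[OF z]) (rule bound)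
  define M where "M = 1 / (2 powr z - 2) * K"
  have sew: "\<bar>sewing A (s, t)\<bar> \<le> M * e powr z" if "\<bar>t - s\<bar> \<le> e" for s t e
  proof -
    have "2 powr z > 2 powr 1" using z by (intro powr_less_mono) auto
    hence "M \<ge> 0" using K_nonneg by (simp add: M_def)
    hence "M * \<bar>t - s\<bar> powr z \<le> M * e powr z"
      using that z by (intro mult_left_mono powr_mono2) auto
    thus ?thesis using sewing_le[of s t] by (simp add: M_def)
  qed
  define I where "I p = R p - sewing A p" for p
  have NN_I: "NN I p = A p - NN (sewing A) p" for p
    by (simp add: I_def NN_def A case_prod_unfold)
  interpret I: midpoint_additive I "K + M * (2 powr z + 2)" z
  proof
    show "z > 1" by (rule z)
    show "I (s, t) = I (s, (s + t) / 2) + I ((s + t) / 2, t)" for s t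
      using NN_I[of "(s, (s + t) / 2, t)"] by (simp only: NN_sewing_midpoint) (simp add: NN_def)
    show "\<bar>NN I (s, u, t)\<bar> \<le> (K + M * (2 powr z + 2)) * d powr z"
      if "\<bar>u - s\<bar> \<le> d" "\<bar>t - u\<bar> \<le> d" for s u t d
    proof -
      have "\<bar>sewing A (s, t)\<bar> \<le> M * (2 * d) powr z" using that by (intro sew) auto
      also have "\<dots> = M * 2 powr z * d powr z" using that by (simp add: powr_mult)
      finally have st: "\<bar>sewing A (s, t)\<bar> \<le> M * 2 powr z * d powr z" .
      have "NN I (s, u, t)
          = A (s, u, t) - (sewing A (s, t) - sewing A (u, t) - sewing A (s, u))"
        by (simp only: NN_I) (simp add: NN_def)
      moreover have "(K + M * (2 powr z + 2)) * d powr z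
          = K * d powr z + M * 2 powr z * d powr z + M * d powr z + M * d powr z"
        by (simp add: algebra_simps)
      ultimately show ?thesis
        using bound[OF that] sew[OF that(1)] sew[OF that(2)] st by linarith
    qed
  qed
  have "continuous_on UNIV I"
    unfolding I_def by (intro continuous_on_diff R_cont continuous_on_sewing A_cont)
  hence "NN (sewing A) p = A p" for p
    using I.additive[of "fst p" "fst (snd p)" "snd (snd p)"] NN_I[of p] by simp
  thus ?thesis by (rule ext)
qed

section \<open>The function spaces\<close>

lemma norm2_bound:
  assumes "norm2 \<rho> \<gamma> B < \<infinity>" "s \<noteq> u" "u \<noteq> t"
  shows "\<bar>B (s, u, t)\<bar> \<le> enn2real (norm2 \<rho> \<gamma> B) * (\<bar>u - s\<bar> powr \<rho> * \<bar>t - u\<bar> powr \<gamma>)"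
proof -
  have "ennreal (\<bar>B (s, u, t)\<bar> / (\<bar>u - s\<bar> powr \<rho> * \<bar>t - u\<bar> powr \<gamma>)) \<le> norm2 \<rho> \<gamma> B"
    unfolding norm2_def by (rule SUP_upper2[of "(s, u, t)"]) (use assms in auto)
  also have "\<dots> = ennreal (enn2real (norm2 \<rho> \<gamma> B))" using assms(1) by simp
  finally have "\<bar>B (s, u, t)\<bar> / (\<bar>u - s\<bar> powr \<rho> * \<bar>t - u\<bar> powr \<gamma>) \<le> enn2real (norm2 \<rho> \<gamma> B)"
    by (simp add: ennreal_le_iff)
  thus ?thesis using assms by (simp add: divide_le_eq)
qed

lemma norm1_bound:
  assumes "X \<in> OmegaC_pow z"
  shows "\<bar>X (s, t)\<bar> \<le> enn2real (norm1 z X) * \<bar>t - s\<bar> powr z"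
proof (cases "s = t")
  case True
  thus ?thesis using assms by (simp add: OmegaC_pow_def OmegaC_cont_def)
next
  case False
  have "ennreal (\<bar>X (s, t)\<bar> / \<bar>t - s\<bar> powr z) \<le> norm1 z X"
    unfolding norm1_def by (rule SUP_upper2[of "(s, t)"]) (use False in auto)
  also have "\<dots> = ennreal (enn2real (norm1 z X))" using assms by (simp add: OmegaC_pow_def)
  finally have "\<bar>X (s, t)\<bar> / \<bar>t - s\<bar> powr z \<le> enn2real (norm1 z X)"
    by (simp add: ennreal_le_iff)
  thus ?thesis using False by (simp add: divide_le_eq)
qed

lemma norm1_le:
  assumes "\<And>s t. \<bar>X (s, t)\<bar> \<le> M * \<bar>t - s\<bar> powr z"
  shows "norm1 z X \<le> ennreal M"
  unfolding norm1_def
  by (rule SUP_least) (use assms in \<open>auto intro!: ennreal_leI simp: divide_le_eq\<close>)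

text \<open>Both increments are at most \<open>d\<close> and the exponents add up to \<open>z\<close>, so the different \<open>\<rho> i\<close>
  disappear. The norms say nothing about triples with two equal neighbours; there \<open>A\<close> vanishes
  because it is of the form \<open>N R\<close>.\<close>

lemma decomposition_bound:
  assumes A: "A = NN R" "R \<in> OmegaC"
    and B: "\<And>i. i < n \<Longrightarrow> 0 < \<rho> i \<and> \<rho> i < z \<and> B i \<in> OmegaC2_pow2 (\<rho> i) (z - \<rho> i)"
    and sum: "A = (\<lambda>p. \<Sum>i<n. c i * B i p)"
    and d: "\<bar>u - s\<bar> \<le> d" "\<bar>t - u\<bar> \<le> d"
  shows "\<bar>A (s, u, t)\<bar> \<le> (\<Sum>i<n. \<bar>c i\<bar> * enn2real (norm2 (\<rho> i) (z - \<rho> i) (B i))) * d powr z"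
proof (cases "s = u \<or> u = t")
  case True
  hence "A (s, u, t) = 0" using A by (auto simp: NN_def OmegaC_def OmegaC_cont_def)
  thus ?thesis by (simp add: sum_nonneg)
next
  case False
  hence "d > 0" using d by auto
  have "\<bar>B i (s, u, t)\<bar> \<le> enn2real (norm2 (\<rho> i) (z - \<rho> i) (B i)) * d powr z" if "i < n" for i
  proof -
    have "\<bar>u - s\<bar> powr \<rho> i * \<bar>t - u\<bar> powr (z - \<rho> i) \<le> d powr \<rho> i * d powr (z - \<rho> i)"
      using d B[OF that] by (intro mult_mono powr_mono2) auto
    also have "\<dots> = d powr z" by (simp flip: powr_add)
    finally have "enn2real (norm2 (\<rho> i) (z - \<rho> i) (B i)) * (\<bar>u - s\<bar> powr \<rho> i * \<bar>t - u\<bar> powr (z - \<rho> i))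
        \<le> enn2real (norm2 (\<rho> i) (z - \<rho> i) (B i)) * d powr z"
      by (intro mult_left_mono) auto
    moreover have "norm2 (\<rho> i) (z - \<rho> i) (B i) < \<infinity>"
      using B[OF that] by (auto simp: OmegaC2_pow2_def)
    ultimately show ?thesis using norm2_bound[of "\<rho> i" "z - \<rho> i" "B i" s u t] False by force
  qed
  hence "\<bar>c i * B i (s, u, t)\<bar> \<le> \<bar>c i\<bar> * enn2real (norm2 (\<rho> i) (z - \<rho> i) (B i)) * d powr z"
    if "i < n" for i
    using that by (simp add: abs_mult mult.assoc mult_left_mono)
  hence "\<bar>\<Sum>i<n. c i * B i (s, u, t)\<bar>
      \<le> (\<Sum>i<n. \<bar>c i\<bar> * enn2real (norm2 (\<rho> i) (z - \<rho> i) (B i)) * d powr z)"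
    by (intro order_trans[OF sum_abs] sum_mono) auto
  thus ?thesis by (simp add: sum sum_distrib_right)
qed

lemma OmegaC2_pow_lincomb:
  assumes "A \<in> OmegaC2_pow z" "B \<in> OmegaC2_pow z"
  shows "(\<lambda>p. a * A p + b * B p) \<in> OmegaC2_pow z"
proof -
  obtain n c \<rho> X where 1: "\<And>i. i < n \<Longrightarrow> 0 < \<rho> i \<and> \<rho> i < z \<and> X i \<in> OmegaC2_pow2 (\<rho> i) (z - \<rho> i)"
    and A: "A = (\<lambda>p. \<Sum>i<(n::nat). c i * X i p)"
    using assms(1) unfolding OmegaC2_pow_def by blast
  obtain m c' \<rho>' X' where 2: "\<And>i. i < m \<Longrightarrow> 0 < \<rho>' i \<and> \<rho>' i < z \<and> X' i \<in> OmegaC2_pow2 (\<rho>' i) (z - \<rho>' i)"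
    and B: "B = (\<lambda>p. \<Sum>i<(m::nat). c' i * X' i p)"
    using assms(2) unfolding OmegaC2_pow_def by blast
  \<comment> \<open>Concatenate the two decompositions.\<close>
  let ?c = "\<lambda>i. if i < n then a * c i else b * c' (i - n)"
  let ?\<rho> = "\<lambda>i. if i < n then \<rho> i else \<rho>' (i - n)"
  let ?X = "\<lambda>i. if i < n then X i else X' (i - n)"
  have "\<forall>i<n + m. 0 < ?\<rho> i \<and> ?\<rho> i < z \<and> ?X i \<in> OmegaC2_pow2 (?\<rho> i) (z - ?\<rho> i)"
    using 1 2 by auto
  moreover have "(\<lambda>p. a * A p + b * B p) = (\<lambda>p. \<Sum>i<n + m. ?c i * ?X i p)"
    by (simp add: A B sum_lessThan_add_split sum_distrib_left mult.assoc)
  ultimately show ?thesis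
    unfolding OmegaC2_pow_def mem_Collect_eq
    by (intro exI[of _ "n + m"] exI[of _ ?c] exI[of _ ?\<rho>] exI[of _ ?X] conjI)
qed

lemma Z2_lincomb:
  assumes "A \<in> Z2" "B \<in> Z2"
  shows "(\<lambda>p. a * A p + b * B p) \<in> Z2"
proof -
  obtain R S where R: "R \<in> OmegaC" "A = NN R" and S: "S \<in> OmegaC" "B = NN S"
    using assms unfolding Z2_def by blast
  let ?T = "\<lambda>p. a * R p + b * S p"
  have "continuous_on UNIV ?T"
    using R S by (auto simp: OmegaC_def OmegaC_cont_def intro!: continuous_intros)
  moreover have "bounded (range ?T)"
    using R S unfolding OmegaC_def
    by (intro bounded_plus_comp bounded_scaleR_comp[where ?'b = real, simplified real_scaleR_def]) auto
  ultimately have "?T \<in> OmegaC" using R S by (auto simp: OmegaC_def OmegaC_cont_def)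
  moreover have "(\<lambda>p. a * A p + b * B p) = NN ?T"
    by (auto simp: R S NN_def fun_eq_iff algebra_simps)
  ultimately show ?thesis unfolding Z2_def by blast
qed

lemma Z2_pow_bounded:
  assumes "A \<in> Z2_pow z"
  obtains R K where "R \<in> OmegaC" "A = NN R"
    "\<And>s u t d. \<bar>u - s\<bar> \<le> d \<Longrightarrow> \<bar>t - u\<bar> \<le> d \<Longrightarrow> \<bar>A (s, u, t)\<bar> \<le> K * d powr z"
proof -
  obtain R where R: "A = NN R" "R \<in> OmegaC" using assms by (auto simp: Z2_pow_def Z2_def)
  obtain n c \<rho> X where 1: "\<And>i. i < n \<Longrightarrow> 0 < \<rho> i \<and> \<rho> i < z \<and> X i \<in> OmegaC2_pow2 (\<rho> i) (z - \<rho> i)"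
    and A: "A = (\<lambda>p. \<Sum>i<(n::nat). c i * X i p)"
    using assms unfolding Z2_pow_def OmegaC2_pow_def by blast
  show ?thesis by (rule that[OF R(2) R(1)]) (rule decomposition_bound[OF R 1 A])
qed

text \<open>The difference of \<open>X\<close> and \<open>Y\<close> is additive and of order \<open>\<bar>t - s\<bar>\<^sup>z\<close>.\<close>

lemma OmegaC_pow_eq_if_NN_eq:
  assumes z: "z > 1" and X: "X \<in> OmegaC_pow z" and Y: "Y \<in> OmegaC_pow z" and NN: "NN X = NN Y"
  shows "X = Y"
proof -
  have "X (s, s + h) - Y (s, s + h) = 0" for s h
  proof (rule halving_scale_eq_0[OF z, of "\<lambda>s h. X (s, s + h) - Y (s, s + h)" 1])
    show "X (s, s + 2 * h) - Y (s, s + 2 * h) = X (s, s + h) - Y (s, s + h) +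
        (X (s + 1 * h, s + 1 * h + h) - Y (s + 1 * h, s + 1 * h + h))" for s h
      using fun_cong[OF NN, of "(s, s + h, s + 2 * h)"] by (simp add: NN_def algebra_simps)
    show "\<bar>X (s, s + h) - Y (s, s + h)\<bar> \<le> (enn2real (norm1 z X) + enn2real (norm1 z Y)) * \<bar>h\<bar> powr z"
      for s h
      using norm1_bound[OF X, of s "s + h"] norm1_bound[OF Y, of s "s + h"]
      by (simp add: distrib_right)
  qed
  from this[of s "t - s" for s t] show ?thesis by (auto simp: fun_eq_iff)
qed

lemma sewing_in_OmegaC_pow:
  assumes z: "z > 1" and A: "A \<in> Z2_pow z"
  shows "sewing A \<in> OmegaC_pow z"
proof -
  obtain R K where R: "R \<in> OmegaC" "A = NN R"
    and K: "\<And>s u t d. \<bar>u - s\<bar> \<le> d \<Longrightarrow> \<bar>t - u\<bar> \<le> d \<Longrightarrow> \<bar>A (s, u, t)\<bar> \<le> K * d powr z"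
    using Z2_pow_bounded[OF A] by blast
  interpret midpoint_control A K z by (rule midpoint_controlI[OF z]) (rule K)
  have R_cont: "continuous_on UNIV R" using R by (auto simp: OmegaC_def OmegaC_cont_def)
  have "continuous_on UNIV A"
    unfolding R(2) by (rule continuous_on_NN[OF R_cont])
  hence "continuous_on UNIV (sewing A)" by (rule continuous_on_sewing)
  moreover have "sewing A (t, t) = 0" for t
  proof -
    have "A (t, t, t) = 0" for t using R by (simp add: NN_def OmegaC_def OmegaC_cont_def)
    thus ?thesis by (simp add: sewing_def dyadic_sum_diag)
  qed
  moreover have "norm1 z (sewing A) < \<infinity>"
    by (rule le_less_trans[OF norm1_le]) (rule sewing_le, simp)
  ultimately show ?thesis by (simp add: OmegaC_pow_def OmegaC_cont_def)
qed

lemma norm1_sewing_le: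
  assumes z: "z > 1" and A: "A \<in> Z2_pow z"
    and B: "\<forall>i<n. 0 < \<rho> i \<and> \<rho> i < z \<and> B i \<in> OmegaC2_pow2 (\<rho> i) (z - \<rho> i)"
    and sum: "A = (\<lambda>p. \<Sum>i<n. B i p)"
  shows "norm1 z (sewing A) \<le> ennreal (1 / (2 powr z - 2)) * (\<Sum>i<n. norm2 (\<rho> i) (z - \<rho> i) (B i))"
proof -
  obtain R where R: "A = NN R" "R \<in> OmegaC" using A by (auto simp: Z2_pow_def Z2_def)
  let ?k = "\<lambda>i. enn2real (norm2 (\<rho> i) (z - \<rho> i) (B i))"
  interpret midpoint_control A "\<Sum>i<n. ?k i" z
    using decomposition_bound[OF R, of n \<rho> z B "\<lambda>_. 1"] B sum
    by (intro midpoint_controlI[OF z]) simp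
  have "2 powr z > 2 powr 1" using z by (intro powr_less_mono) auto
  have "norm1 z (sewing A) \<le> ennreal (1 / (2 powr z - 2) * (\<Sum>i<n. ?k i))"
    by (rule norm1_le) (rule sewing_le)
  also have "\<dots> = ennreal (1 / (2 powr z - 2)) * (\<Sum>i<n. ennreal (?k i))"
    using \<open>2 powr z > 2 powr 1\<close> by (subst ennreal_mult) (auto simp: sum_nonneg)
  also have "(\<Sum>i<n. ennreal (?k i)) = (\<Sum>i<n. norm2 (\<rho> i) (z - \<rho> i) (B i))"
    using B by (intro sum.cong) (auto simp: OmegaC2_pow2_def)
  finally show ?thesis .
qed

lemma sewing_lincomb:
  assumes z: "z > 1" and A: "A \<in> Z2_pow z" and B: "B \<in> Z2_pow z"
  shows "sewing (\<lambda>p. a * A p + b * B p) = (\<lambda>p. a * sewing A p + b * sewing B p)"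
proof -
  have summable: "summable (\<lambda>n. dyadic_sum X n s t)" if X: "X \<in> Z2_pow z" for X s t
  proof -
    obtain R K where "R \<in> OmegaC" "X = NN R"
      and K: "\<And>s u t d. \<bar>u - s\<bar> \<le> d \<Longrightarrow> \<bar>t - u\<bar> \<le> d \<Longrightarrow> \<bar>X (s, u, t)\<bar> \<le> K * d powr z"
      using Z2_pow_bounded[OF X] by blast
    interpret midpoint_control X K z by (rule midpoint_controlI[OF z]) (rule K)
    show ?thesis by (rule summable_dyadic_sum)
  qed
  have "sewing (\<lambda>p. a * A p + b * B p) (s, t) = a * sewing A (s, t) + b * sewing B (s, t)" for s t
  proof -
    have "sewing (\<lambda>p. a * A p + b * B p) (s, t)
        = (\<Sum>n. a * dyadic_sum A n s t + b * dyadic_sum B n s t)"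
      by (simp add: sewing_def dyadic_sum_lincomb)
    also have "\<dots> = (\<Sum>n. a * dyadic_sum A n s t) + (\<Sum>n. b * dyadic_sum B n s t)"
      by (rule suminf_add[symmetric]) (intro summable_mult summable A B)+
    also have "\<dots> = a * sewing A (s, t) + b * sewing B (s, t)"
      by (simp only: sewing_def prod.case suminf_mult[OF summable[OF A]] suminf_mult[OF summable[OF B]])
    finally show ?thesis .
  qed
  thus ?thesis by (intro ext) (simp only: split_paired_all)
qed

theorem proposition1:
  fixes z :: real
  assumes "z > 1"
  shows "\<exists>!\<Lambda>. \<Lambda> \<in> Z2_pow z \<rightarrow>\<^sub>E OmegaC_pow z \<and>
    (\<forall>A \<in> Z2_pow z. \<forall>B \<in> Z2_pow z. \<forall>a b :: real.
       \<Lambda> (\<lambda>p. a * A p + b * B p) = (\<lambda>p. a * \<Lambda> A p + b * \<Lambda> B p)) \<and>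
    (\<forall>A \<in> Z2_pow z. NN (\<Lambda> A) = A) \<and>
    (\<forall>A \<in> Z2_pow z. \<forall>(n::nat) \<rho> B.
       n \<ge> 1 \<and>
       (\<forall>i<n. 0 < \<rho> i \<and> \<rho> i < z \<and> B i \<in> OmegaC2_pow2 (\<rho> i) (z - \<rho> i)) \<and>
       A = (\<lambda>p. \<Sum>i<n. B i p) \<longrightarrow>
       norm1 z (\<Lambda> A) \<le> ennreal (1 / (2 powr z - 2)) * (\<Sum>i<n. norm2 (\<rho> i) (z - \<rho> i) (B i)))"
    (is "\<exists>!\<Lambda>. ?P \<Lambda>")
proof (rule ex1I)
  let ?L = "restrict sewing (Z2_pow z)"
  have lincomb: "(\<lambda>p. a * A p + b * B p) \<in> Z2_pow z"
    if "A \<in> Z2_pow z" "B \<in> Z2_pow z" for A B and a b :: real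
    using that OmegaC2_pow_lincomb Z2_lincomb by (auto simp: Z2_pow_def)
  have NN: "NN (sewing A) = A" if A: "A \<in> Z2_pow z" for A
  proof -
    obtain R K where R: "R \<in> OmegaC" "A = NN R"
      and K: "\<And>s u t d. \<bar>u - s\<bar> \<le> d \<Longrightarrow> \<bar>t - u\<bar> \<le> d \<Longrightarrow> \<bar>A (s, u, t)\<bar> \<le> K * d powr z"
      using Z2_pow_bounded[OF A] by blast
    show ?thesis by (rule NN_sewing[OF assms R]) (rule K)
  qed
  show "?P ?L"
  proof (intro conjI ballI allI impI)
    show "?L \<in> Z2_pow z \<rightarrow>\<^sub>E OmegaC_pow z"
      by (rule restrict_PiE_iff[THEN iffD2]) (blast intro: sewing_in_OmegaC_pow[OF assms])
    show "?L (\<lambda>p. a * A p + b * B p) = (\<lambda>p. a * ?L A p + b * ?L B p)"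
      if "A \<in> Z2_pow z" "B \<in> Z2_pow z" for A B and a b :: real
      by (simp only: restrict_apply' that lincomb[OF that] sewing_lincomb[OF assms that])
    show "NN (?L A) = A" if "A \<in> Z2_pow z" for A
      by (simp only: restrict_apply' that NN)
    show "norm1 z (?L A) \<le>
        ennreal (1 / (2 powr z - 2)) * (\<Sum>i<n. norm2 (\<rho> i) (z - \<rho> i) (B i))"
      if A: "A \<in> Z2_pow z" and n: "n \<ge> 1 \<and>
         (\<forall>i<n. 0 < \<rho> i \<and> \<rho> i < z \<and> B i \<in> OmegaC2_pow2 (\<rho> i) (z - \<rho> i)) \<and>
         A = (\<lambda>p. \<Sum>i<n. B i p)" for A B \<rho> and n :: nat
    proof -
      have "norm1 z (sewing A) \<le>
          ennreal (1 / (2 powr z - 2)) * (\<Sum>i<n. norm2 (\<rho> i) (z - \<rho> i) (B i))"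
        by (rule norm1_sewing_le[OF assms A]) (use n in blast)+
      thus ?thesis by (simp only: restrict_apply' A)
    qed
  qed
  show "\<Lambda> = ?L" if "?P \<Lambda>" for \<Lambda>
  proof (rule PiE_ext)
    show "\<Lambda> \<in> Z2_pow z \<rightarrow>\<^sub>E OmegaC_pow z" using that by blast
    show "?L \<in> Z2_pow z \<rightarrow>\<^sub>E OmegaC_pow z"
      by (rule restrict_PiE_iff[THEN iffD2]) (blast intro: sewing_in_OmegaC_pow[OF assms])
    show "\<Lambda> A = ?L A" if A: "A \<in> Z2_pow z" for A
    proof (rule OmegaC_pow_eq_if_NN_eq[OF assms])
      show "\<Lambda> A \<in> OmegaC_pow z" using \<open>?P \<Lambda>\<close> A by blast
      show "?L A \<in> OmegaC_pow z"
        by (simp only: restrict_apply' A sewing_in_OmegaC_pow[OF assms A])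
      have "NN (\<Lambda> A) = A" using \<open>?P \<Lambda>\<close> A by blast
      thus "NN (\<Lambda> A) = NN (?L A)" by (simp only: restrict_apply' A NN)
    qed
  qed
qed

end
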